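(* Let $\mathbb{H}$ be the division algebra of (real) quaternions, and consider the polynomials $p(x,y)=xy-yx$ and $g(x,y)=x^2y+yx^2-2xyx$ in two non-commuting variables $x,y$ over $\mathbb{H}$. Then $p$ and $g$ do not have a common factor with the same zero set; that is, there is no polynomial $f$ in non-commuting variables $x,y$ over $\mathbb{H}$ which is a factor of both $p$ and $g$ and whose zero set in $\mathbb{H}^2$ equals the zero set of $p$ and $g$.
   Context: Polynomials over $\mathbb{H}$ are elements of the free algebra $\mathbb{H}\langle x,y\rangle$: finite sums $\sum_w c_w w$ with $c_w\in\mathbb{H}$ and $w$ ranging over words in $x,y$, where $x$ and $y$ do not commute with each other but do commute with the coefficients in $\mathbb{H}$ when polynomials are multiplied. The value of $\sum_w c_w w$ at $(a,b)\in\mathbb{H}^2$ is obtained by substituting $x=a$, $y=b$ in the words $w$, with the coefficients $c_w$ written on the left; the zero set is the set of $(a,b)\in\mathbb{H}^2$ where this value is $0$. The zero set of $p$, and also of $g$, is the set of all commuting pairs of quaternions. A polynomial $f$ is a factor of (divides) a polynomial $q$ if $q=fh$ or $q=hf$ for some $h\in\mathbb{H}\langle x,y\rangle$. *)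

theory Defs
  imports Complex_Main "HOL-Library.Poly_Mapping"
begin

section \<open>The real quaternions\<close>

codatatype quat = Quat (qRe: real) (qI: real) (qJ: real) (qK: real)

lemma quat_eq_iff: "x = y \<longleftrightarrow> qRe x = qRe y \<and> qI x = qI y \<and> qJ x = qJ y \<and> qK x = qK y"
  by (auto intro: quat.expand)

instantiation quat :: ab_group_add
begin

primcorec zero_quat
  where "qRe 0 = 0" | "qI 0 = 0" | "qJ 0 = 0" | "qK 0 = 0"

primcorec plus_quat
  where
    "qRe (x + y) = qRe x + qRe y"
  | "qI (x + y) = qI x + qI y"
  | "qJ (x + y) = qJ x + qJ y"
  | "qK (x + y) = qK x + qK y"

primcorec uminus_quat
  where
    "qRe (- x) = - qRe x"
  | "qI (- x) = - qI x"
  | "qJ (- x) = - qJ x"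
  | "qK (- x) = - qK x"

primcorec minus_quat
  where
    "qRe (x - y) = qRe x - qRe y"
  | "qI (x - y) = qI x - qI y"
  | "qJ (x - y) = qJ x - qJ y"
  | "qK (x - y) = qK x - qK y"

instance
  by standard (simp_all add: quat_eq_iff)

end

definition qnorm2 :: "quat \<Rightarrow> real"
  where "qnorm2 x = (qRe x)\<^sup>2 + (qI x)\<^sup>2 + (qJ x)\<^sup>2 + (qK x)\<^sup>2"

lemma qnorm2_eq_0_iff: "qnorm2 x = 0 \<longleftrightarrow> x = 0"
  unfolding qnorm2_def quat_eq_iff
  by (simp add: add_nonneg_eq_0_iff)

instantiation quat :: real_div_algebra
begin

primcorec one_quat
  where "qRe 1 = 1" | "qI 1 = 0" | "qJ 1 = 0" | "qK 1 = 0"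

primcorec times_quat
  where
    "qRe (x * y) = qRe x * qRe y - qI x * qI y - qJ x * qJ y - qK x * qK y"
  | "qI (x * y) = qRe x * qI y + qI x * qRe y + qJ x * qK y - qK x * qJ y"
  | "qJ (x * y) = qRe x * qJ y - qI x * qK y + qJ x * qRe y + qK x * qI y"
  | "qK (x * y) = qRe x * qK y + qI x * qJ y - qJ x * qI y + qK x * qRe y"

primcorec scaleR_quat
  where
    "qRe (scaleR r x) = r * qRe x"
  | "qI (scaleR r x) = r * qI x"
  | "qJ (scaleR r x) = r * qJ x"
  | "qK (scaleR r x) = r * qK x"

primcorec inverse_quat
  where
    "qRe (inverse x) = qRe x / qnorm2 x"
  | "qI (inverse x) = - qI x / qnorm2 x"
  | "qJ (inverse x) = - qJ x / qnorm2 x"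
  | "qK (inverse x) = - qK x / qnorm2 x"

definition "x div y = x * inverse y" for x y :: quat

instance
proof
  fix x y z :: quat and r s :: real
  show "x * y * z = x * (y * z)"
    by (simp add: quat_eq_iff algebra_simps)
  show "(x + y) * z = x * z + y * z" "x * (y + z) = x * y + x * z"
    by (simp_all add: quat_eq_iff algebra_simps)
  show "1 * x = x" "x * 1 = x"
    by (simp_all add: quat_eq_iff)
  show "(0::quat) \<noteq> 1"
    by (simp add: quat_eq_iff)
  show "scaleR r (x + y) = scaleR r x + scaleR r y" "scaleR (r + s) x = scaleR r x + scaleR s x"
    "scaleR r (scaleR s x) = scaleR (r * s) x" "scaleR 1 x = x"
    "scaleR r x * y = scaleR r (x * y)" "x * scaleR r y = scaleR r (x * y)"
    by (simp_all add: quat_eq_iff algebra_simps)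
  show "x div y = x * inverse y"
    by (simp add: divide_quat_def)
  show "inverse (0::quat) = 0"
    by (simp add: quat_eq_iff)
  assume "x \<noteq> 0"
  then have n: "qnorm2 x \<noteq> 0"
    by (simp add: qnorm2_eq_0_iff)
  have d: "qRe x * qRe x / qnorm2 x + qI x * qI x / qnorm2 x
      + qJ x * qJ x / qnorm2 x + qK x * qK x / qnorm2 x = 1"
    using n by (simp add: add_divide_distrib [symmetric] qnorm2_def power2_eq_square)
  show "inverse x * x = 1" "x * inverse x = 1"
    using d by (simp_all add: quat_eq_iff algebra_simps)
qed

end


section \<open>Non-commutative polynomials in two variables over the quaternions\<close>

datatype letter = LX | LY

text \<open>
  Lists under concatenation form the free monoid. It is written additively because
  the product on \<^typ>\<open>'a \<Rightarrow>\<^sub>0 'b\<close> is convolution along \<open>+\<close> of the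
  index monoid; on words this gives \<open>(c u) (d v) = (c d) (u v)\<close>, so that the variables commute
  with the coefficients but not with each other.
\<close>

instantiation list :: (type) monoid_add
begin

definition zero_list :: "'a list" where "0 = []"

definition plus_list :: "'a list \<Rightarrow> 'a list \<Rightarrow> 'a list" where "u + v = u @ v"

instance
  by standard (simp_all add: zero_list_def plus_list_def)

end

type_synonym ncpoly = "letter list \<Rightarrow>\<^sub>0 quat"

definition varX :: ncpoly where "varX = Poly_Mapping.single [LX] 1"

definition varY :: ncpoly where "varY = Poly_Mapping.single [LY] 1"

definition word_eval :: "quat \<Rightarrow> quat \<Rightarrow> letter list \<Rightarrow> quat"
  where "word_eval a b w = prod_list (map (case_letter a b) w)"

definition nc_eval :: "ncpoly \<Rightarrow> quat \<Rightarrow> quat \<Rightarrow> quat"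
  where "nc_eval f a b = (\<Sum>w\<in>Poly_Mapping.keys f. Poly_Mapping.lookup f w * word_eval a b w)"

definition zero_set :: "ncpoly \<Rightarrow> (quat \<times> quat) set"
  where "zero_set f = {(a, b). nc_eval f a b = 0}"

text \<open>Not the library's \<open>dvd\<close>: here left and right factors are both allowed.\<close>

definition factor_of :: "ncpoly \<Rightarrow> ncpoly \<Rightarrow> bool"
  where "factor_of f q \<longleftrightarrow> (\<exists>h. q = f * h \<or> q = h * f)"

definition p_poly :: ncpoly
  where "p_poly = varX * varY - varY * varX"

definition g_poly :: ncpoly
  where "g_poly = varX\<^sup>2 * varY + varY * varX\<^sup>2 - 2 * varX * varY * varX"


section \<open>The zero sets of the two polynomials\<close>

lemma nc_eval_superset:
  assumes "finite A" "Poly_Mapping.keys f \<subseteq> A"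
  shows "nc_eval f a b = (\<Sum>w\<in>A. Poly_Mapping.lookup f w * word_eval a b w)"
  unfolding nc_eval_def
  by (rule sum.mono_neutral_left) (use assms in \<open>auto simp: in_keys_iff\<close>)

lemma nc_eval_add: "nc_eval (f + g) a b = nc_eval f a b + nc_eval g a b"
proof -
  let ?A = "Poly_Mapping.keys f \<union> Poly_Mapping.keys g"
  have "Poly_Mapping.keys (f + g) \<subseteq> ?A"
    by (rule keys_add)
  then show ?thesis
    by (simp add: nc_eval_superset [of ?A] lookup_add distrib_right sum.distrib)
qed

lemma nc_eval_uminus: "nc_eval (- f) a b = - nc_eval f a b"
  by (simp add: nc_eval_def sum_negf)

lemma nc_eval_diff: "nc_eval (f - g) a b = nc_eval f a b - nc_eval g a b"
  using nc_eval_add [of f "- g" a b] by (simp add: nc_eval_uminus)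

lemma nc_eval_single: "nc_eval (Poly_Mapping.single w c) a b = c * word_eval a b w"
  by (cases "c = 0") (simp_all add: nc_eval_def)

lemma nc_eval_p: "nc_eval p_poly a b = a * b - b * a"
  by (simp add: p_poly_def varX_def varY_def mult_single plus_list_def nc_eval_diff
      nc_eval_single word_eval_def)

lemma nc_eval_g: "nc_eval g_poly a b = a\<^sup>2 * b + b * a\<^sup>2 - 2 * a * b * a"
  by (simp add: g_poly_def varX_def varY_def power2_eq_square mult_2 mult_single plus_list_def
      nc_eval_add nc_eval_diff nc_eval_single word_eval_def distrib_right mult.assoc)

lemma zero_set_p: "zero_set p_poly = {(a, b). a * b = b * a}"
  by (simp add: zero_set_def nc_eval_p)

lemma zero_set_g: "zero_set g_poly = {(a, b). a * b = b * a}"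
proof -
  have "a * b = b * a" if "a\<^sup>2 * b + b * a\<^sup>2 - 2 * a * b * a = 0" for a b :: quat
  proof -
    define u where "u = a * b - b * a"
    define n where "n = (qI a)\<^sup>2 + (qJ a)\<^sup>2 + (qK a)\<^sup>2"
    have "a * u - u * a = 0"
      using that by (simp add: u_def power2_eq_square algebra_simps mult_2)
    then have "qI (a * u - u * a) = 0" "qJ (a * u - u * a) = 0" "qK (a * u - u * a) = 0"
      by simp_all
    then have c: "qJ a * qK u = qK a * qJ u" "qK a * qI u = qI a * qK u" "qI a * qJ u = qJ a * qI u"
      by (simp_all only: minus_quat.simps times_quat.simps; algebra)+
    have r: "qRe u = 0"
      by (simp add: u_def)
    have d: "qI a * qI u + qJ a * qJ u + qK a * qK u = 0"
      by (simp add: u_def algebra_simps)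
    have "n * qnorm2 u = (qI a * qI u + qJ a * qJ u + qK a * qK u)\<^sup>2
        + (qJ a * qK u - qK a * qJ u)\<^sup>2 + (qK a * qI u - qI a * qK u)\<^sup>2
        + (qI a * qJ u - qJ a * qI u)\<^sup>2"
      by (simp add: n_def qnorm2_def r power2_eq_square algebra_simps)
    also have "\<dots> = 0"
      unfolding d using c by simp
    finally have "n = 0 \<or> u = 0"
      by (simp add: qnorm2_eq_0_iff)
    moreover have "u = 0" if "n = 0"
    proof -
      have "qI a = 0 \<and> qJ a = 0 \<and> qK a = 0"
        using that unfolding n_def by (simp add: add_nonneg_eq_0_iff)
      then show ?thesis
        by (simp add: u_def quat_eq_iff)
    qed
    ultimately show ?thesis
      by (auto simp: u_def)
  qed
  moreover have "a\<^sup>2 * b + b * a\<^sup>2 - 2 * a * b * a = 0" if "a * b = b * a" for a b :: quat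
  proof -
    have "b * (a * a) = a * (b * a)" "a * (a * b) = a * (b * a)"
      using that by (metis mult.assoc)+
    then show ?thesis
      by (simp add: power2_eq_square mult_2 distrib_right mult.assoc)
  qed
  ultimately show ?thesis
    unfolding zero_set_def nc_eval_g by blast
qed

end

theory Submission
  imports Defs
begin

text \<open>
  Only coefficients of words of length at most three matter. A factor \<open>f\<close> that vanishes at
  \<open>(0, 0)\<close> has no constant term. If it divides \<open>p\<close>, comparing coefficients of degree at most two
  shows that \<open>f\<close> has no linear part either, because \<open>xy - yx\<close> is not a product of two linear forms.
  So the cofactor has a nonzero constant term, and the quadratic part of \<open>f\<close> is a nonzero multiple
  of \<open>xy - yx\<close>. If \<open>f\<close> also divides \<open>g\<close>, the cofactor there has no constant term, so
  \<open>g\<close> is the product of the quadratic part of \<open>f\<close> and a linear form. As \<open>f\<close> has no \<open>xx\<close> term,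
  such a product lacks the word \<open>xxy\<close> if \<open>f\<close> is on the left and \<open>yxx\<close> if \<open>f\<close> is on the right,
  whereas both occur in \<open>g\<close>.
\<close>

text \<open>Factorizations \<open>w = u + v\<close> in the free monoid correspond to cut positions
  \<open>i\<close>, so the convolution reduces to a finite sum.\<close>

lemma lookup_times_list:
  fixes f h :: "'a list \<Rightarrow>\<^sub>0 'b::semiring_0"
  shows "Poly_Mapping.lookup (f * h) w =
    (\<Sum>i\<le>length w. Poly_Mapping.lookup f (take i w) * Poly_Mapping.lookup h (drop i w))"
proof -
  let ?A = "(\<lambda>i. take i w) ` {..length w}"
  let ?s = "\<lambda>u. Sum_any (\<lambda>v. Poly_Mapping.lookup h v when w = u + v)"
  have inner: "?s (take i w) = Poly_Mapping.lookup h (drop i w)" for i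
  proof -
    have "w = take i w + v \<longleftrightarrow> drop i w = v" for v
      by (metis append_take_drop_id plus_list_def same_append_eq)
    then show ?thesis
      by simp
  qed
  have "Poly_Mapping.lookup (f * h) w = Sum_any (\<lambda>u. Poly_Mapping.lookup f u * ?s u)"
    by (simp add: lookup_mult)
  also have "\<dots> = (\<Sum>u\<in>?A. Poly_Mapping.lookup f u * ?s u)"
  proof (rule Sum_any.expand_superset)
    show "{u. Poly_Mapping.lookup f u * ?s u \<noteq> 0} \<subseteq> ?A"
    proof
      fix u
      assume "u \<in> {u. Poly_Mapping.lookup f u * ?s u \<noteq> 0}"
      then have "?s u \<noteq> 0"
        by auto
      moreover have "?s u = 0" if "\<forall>v. w \<noteq> u + v"
        using that by simp
      ultimately obtain v where "w = u + v"
        by blast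
      then have "u = take (length u) w" "length u \<le> length w"
        by (simp_all add: plus_list_def)
      then show "u \<in> ?A"
        by blast
    qed
  qed simp
  also have "\<dots> = (\<Sum>i\<le>length w. Poly_Mapping.lookup f (take i w) * ?s (take i w))"
  proof (rule sum.reindex_cong [OF _ refl refl])
    show "inj_on (\<lambda>i. take i w) {..length w}"
      by (rule inj_on_inverseI [of _ length]) simp
  qed
  finally show ?thesis
    by (simp add: inner)
qed

lemma p_poly_eq: "p_poly = Poly_Mapping.single [LX, LY] 1 - Poly_Mapping.single [LY, LX] 1"
  by (simp add: p_poly_def varX_def varY_def mult_single plus_list_def)

lemma g_poly_eq: "g_poly = Poly_Mapping.single [LX, LX, LY] 1 + Poly_Mapping.single [LY, LX, LX] 1
    - (Poly_Mapping.single [LX, LY, LX] 1 + Poly_Mapping.single [LX, LY, LX] 1)"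
  by (simp add: g_poly_def varX_def varY_def power2_eq_square mult_2 mult_single plus_list_def
      distrib_right)

lemma nc_eval_0_0: "nc_eval f 0 0 = Poly_Mapping.lookup f []"
proof -
  have e: "word_eval 0 0 w = (if w = [] then 1 else 0)" for w
    by (cases w) (auto simp: word_eval_def split: letter.split)
  \<comment> \<open>The empty word is inserted because it may lie outside the support of
    \<open>f\<close>.\<close>
  have "nc_eval f 0 0
      = (\<Sum>w\<in>insert [] (Poly_Mapping.keys f). Poly_Mapping.lookup f w * word_eval 0 0 w)"
    by (rule nc_eval_superset) auto
  then show ?thesis
    by (simp add: e if_distrib [of "times _"] cong: if_cong)
qed

lemma factor_of_p_coeffs:
  assumes "factor_of f p_poly" and 0: "Poly_Mapping.lookup f [] = 0"
  shows "Poly_Mapping.lookup f [LX] = 0" and "Poly_Mapping.lookup f [LY] = 0"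
    and "Poly_Mapping.lookup f [LX, LX] = 0" and "Poly_Mapping.lookup f [LX, LY] \<noteq> 0"
proof -
  let ?f = "Poly_Mapping.lookup f"
  have p: "Poly_Mapping.lookup p_poly [LX] = 0" "Poly_Mapping.lookup p_poly [LY] = 0"
    "Poly_Mapping.lookup p_poly [LX, LX] = 0" "Poly_Mapping.lookup p_poly [LY, LY] = 0"
    "Poly_Mapping.lookup p_poly [LX, LY] = 1" "Poly_Mapping.lookup p_poly [LY, LX] = - 1"
    by (simp_all add: p_poly_eq lookup_minus lookup_single)
  obtain h where "p_poly = f * h \<or> p_poly = h * f"
    using assms(1) by (auto simp: factor_of_def)
  then have "?f [LX] = 0 \<and> ?f [LY] = 0 \<and> ?f [LX, LX] = 0 \<and> ?f [LX, LY] \<noteq> 0"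
  proof
    let ?h = "Poly_Mapping.lookup h"
    assume eq: "p_poly = f * h"
    have e: "?f [LX] * ?h [] = 0" "?f [LY] * ?h [] = 0"
      "?f [LX] * ?h [LX] + ?f [LX, LX] * ?h [] = 0" "?f [LY] * ?h [LY] + ?f [LY, LY] * ?h [] = 0"
      "?f [LX] * ?h [LY] + ?f [LX, LY] * ?h [] = 1" "?f [LY] * ?h [LX] + ?f [LY, LX] * ?h [] = - 1"
      using p unfolding eq by (simp_all add: lookup_times_list 0)
    \<comment> \<open>Otherwise \<open>e(5)\<close> and \<open>e(6)\<close> make
      \<open>?f [LX]\<close> and \<open>?h [LX]\<close> nonzero, while \<open>e(3)\<close> says
      their product is 0.\<close>
    have h0: "?h [] \<noteq> 0"
    proof
      assume "?h [] = 0"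
      with e show False
        by auto
    qed
    with e(1,2) have "?f [LX] = 0" "?f [LY] = 0"
      by simp_all
    with e(3,5) h0 show ?thesis
      by auto
  next
    let ?h = "Poly_Mapping.lookup h"
    assume eq: "p_poly = h * f"
    have e: "?h [] * ?f [LX] = 0" "?h [] * ?f [LY] = 0"
      "?h [] * ?f [LX, LX] + ?h [LX] * ?f [LX] = 0" "?h [] * ?f [LY, LY] + ?h [LY] * ?f [LY] = 0"
      "?h [] * ?f [LX, LY] + ?h [LX] * ?f [LY] = 1" "?h [] * ?f [LY, LX] + ?h [LY] * ?f [LX] = - 1"
      using p unfolding eq by (simp_all add: lookup_times_list 0)
    have h0: "?h [] \<noteq> 0"
    proof
      assume "?h [] = 0"
      with e show False
        by auto
    qed
    with e(1,2) have "?f [LX] = 0" "?f [LY] = 0"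
      by simp_all
    with e(3,5) h0 show ?thesis
      by auto
  qed
  then show "?f [LX] = 0" "?f [LY] = 0" "?f [LX, LX] = 0" "?f [LX, LY] \<noteq> 0"
    by auto
qed

theorem theorem10:
  shows "\<not> (\<exists>f :: ncpoly. factor_of f p_poly \<and> factor_of f g_poly
    \<and> zero_set f = zero_set p_poly \<and> zero_set f = zero_set g_poly)"
proof
  assume "\<exists>f :: ncpoly. factor_of f p_poly \<and> factor_of f g_poly
    \<and> zero_set f = zero_set p_poly \<and> zero_set f = zero_set g_poly"
  then obtain f where fp: "factor_of f p_poly" and fg: "factor_of f g_poly"
    and z: "zero_set f = zero_set p_poly"
    by blast
  have "(0, 0) \<in> zero_set f"
    by (simp add: z zero_set_p)
  then have 0: "Poly_Mapping.lookup f [] = 0"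
    by (simp add: zero_set_def nc_eval_0_0)
  note c = factor_of_p_coeffs [OF fp 0]
  have g: "Poly_Mapping.lookup g_poly [LX, LY] = 0" "Poly_Mapping.lookup g_poly [LX, LX, LY] = 1"
    "Poly_Mapping.lookup g_poly [LY, LX, LX] = 1"
    by (simp_all add: g_poly_eq lookup_minus lookup_add lookup_single)
  obtain h where "g_poly = f * h \<or> g_poly = h * f"
    using fg by (auto simp: factor_of_def)
  then show False
  proof
    assume eq: "g_poly = f * h"
    \<comment> \<open>The coefficient of xy in the product is
      \<open>lookup f [LX, LY] * lookup h []\<close>, and g has no term xy.\<close>
    have "Poly_Mapping.lookup h [] = 0"
      using g(1) c(4) unfolding eq by (simp add: lookup_times_list 0 c(1-3))
    then show False
      using g(2) unfolding eq by (simp add: lookup_times_list 0 c(1-3))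
  next
    assume eq: "g_poly = h * f"
    have "Poly_Mapping.lookup h [] = 0"
      using g(1) c(4) unfolding eq by (simp add: lookup_times_list 0 c(1-3))
    \<comment> \<open>Each way of cutting yxx leaves \<open>f\<close> the suffix yxx, xx, x or the
      empty word: the first meets the zero constant term of \<open>h\<close>, the others have
      coefficient 0 in \<open>f\<close>.\<close>
    then show False
      using g(3) unfolding eq by (simp add: lookup_times_list 0 c(1-3))
  qed
qed

end
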